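(* Let $(X,\mathcal{C}_0,\mathcal{F},\tau)$ be a measurable locally convex space, $D$ a convex subset of $X$, $\mu$ a probability measure on $(X,\mathcal{F})$ carried by $D$, $(\mu_n)_{n\ge1}$ the Cramér sequence associated with $\mu$ (with $\overline{X}_n$ of law $\mu_n$) and $s$ its entropy. For every measurable function $f:X\to[-\infty,+\infty]$ and every $K\in\mathcal{F}$ such that $K\cap D$ is relatively compact, $$\limsup_{n\to\infty}\frac1n\log\mathbb{E}\Big(e^{nf(\overline{X}_n)}1_{\overline{X}_n\in K}\Big)\le\sup_{\overline{K\cap D}}\,[f^\bullet\,\dot{+}\,s].$$
   Context: **Measurable locally convex space.** Let $X$ be a real vector space. For a convex set $C\subset X$ containing $0$, its gauge is $M_C(x)=\inf\{t\ge0: x\in tC\}\in[0,+\infty]$. $C$ is an internal convex set if $M_C$ is finite everywhere and $C=\{x\in X: M_C(x)<1\}$. For such $C$, $\tau_C$ denotes the (not necessarily Hausdorff) locally convex topology on $X$ generated by the neighbourhoods $tC$, $t\in\mathbb{R}\setminus\{0\}$, of $0$. A measurable locally convex space is a quadruple $(X,\mathcal{C}_0,\mathcal{F},\tau)$ where $\mathcal{C}_0$ is a family of convex subsets of $X$ such that: (i) every $C\in\mathcal{C}_0$ is an internal convex set, symmetric ($C=-C$), and $\tau_C$ is separable; (ii) $\mathcal{C}_0$ is stable under finite intersections and under dilations $C\mapsto tC$, $t\ne0$; (iii) the intersection of all elements of $\mathcal{C}_0$ is $\{0\}$. Then $\tau$ is the Hausdorff locally convex topology having $\mathcal{C}_0$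 as a fundamental system of neighbourhoods of $0$; $\mathcal{C}_x=\{x+C: C\in\mathcal{C}_0\}$; and $\mathcal{F}=\sigma\big(\bigcup_{x\in X}\mathcal{C}_x\big)$. Topological notions refer to $\tau$. Vector addition $X^2\to X$ is $\mathcal{F}^{\otimes2}$-$\mathcal{F}$ measurable. **Cramér sequence, entropy.** Given a probability $\mu$ on $\mathcal{F}$, let $(X_n)_{n\ge1}$ be i.i.d. with law $\mu$, $\overline{X}_n=\frac1n\sum_{k=1}^nX_k$, and $\mu_n$ the law of $\overline{X}_n$; $(\mu_n)_{n\ge1}$ is the Cramér sequence associated with $\mu$. Its entropy is $s:X\to[-\infty,0]$, $s(x)=\inf_{C\in\mathcal{C}_x}\liminf_{n\to\infty}\frac1n\log\mu_n(C)$. **Carried.** $\mu$ is carried by $D\subset X$ if for all $A,B\in\mathcal{F}$, $A\cap D=B\cap D$ implies $\mu(A)=\mu(B)$. When $\mu$ is carried by a convex $D$, the $X_n$ are taken $D$-valued (so $\overline{X}_n\in D$). A set is relatively compact if it is contained in a compact set. **Notation.** $f$ is upper semicontinuous if $\{f<t\}$ is open for every $t\in[-\infty,+\infty]$; $f^\bullet$ is the smallest upper semicontinuous function $\ge f$. $\dot{+}$ is the extension of addition to $[-\infty,+\infty]$ with $-\infty\,\dot{+}\,(+\infty)=+\infty$. Conventions: $e^{+\infty}=+\infty$, $e^{-\infty}=0$, $\log0=-\infty$, $\sup\emptyset=-\infty$. *)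

theory Defs
  imports "HOL-Probability.Probability"
begin

definition convex_gauge :: "'a::real_vector set \<Rightarrow> 'a \<Rightarrow> ereal" where
  "convex_gauge C x = Inf {ereal t | t. 0 \<le> t \<and> x \<in> (*\<^sub>R) t ` C}"

definition internal_convex :: "'a::real_vector set \<Rightarrow> bool" where
  "internal_convex C \<longleftrightarrow>
     convex C \<and> 0 \<in> C \<and> (\<forall>x. convex_gauge C x < \<infinity>) \<and> C = {x. convex_gauge C x < 1}"

text \<open>The translation-invariant topology in which the finite intersections of members of \<open>N\<close>
  (the empty intersection being the whole space) form a fundamental system of neighbourhoods
  of 0. In the two uses below the translates of the members of \<open>N\<close> are open.\<close>

definition nbhd_topology :: "'a::real_vector set set \<Rightarrow> 'a topology" where
  "nbhd_topology N =
     topology (\<lambda>U. \<forall>x\<in>U. \<exists>F\<subseteq>N. finite F \<and> (+) x ` \<Inter>F \<subseteq> U)"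

lemma openin_nbhd_topology:
  "openin (nbhd_topology N) U \<longleftrightarrow> (\<forall>x\<in>U. \<exists>F\<subseteq>N. finite F \<and> (+) x ` \<Inter>F \<subseteq> U)"
proof -
  let ?P = "\<lambda>U. \<forall>x\<in>U. \<exists>F\<subseteq>N. finite F \<and> (+) x ` \<Inter>F \<subseteq> U"
  have "?P (S \<inter> T)" if S: "?P S" and T: "?P T" for S T
  proof
    fix x assume "x \<in> S \<inter> T"
    then obtain F G where F: "F \<subseteq> N" "finite F" "(+) x ` \<Inter>F \<subseteq> S"
      and G: "G \<subseteq> N" "finite G" "(+) x ` \<Inter>G \<subseteq> T"
      using S T by (meson IntD1 IntD2)
    have "(+) x ` \<Inter>(F \<union> G) \<subseteq> S \<inter> T"
      using F(3) G(3) by (auto simp: image_subset_iff)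
    then show "\<exists>F\<subseteq>N. finite F \<and> (+) x ` \<Inter>F \<subseteq> S \<inter> T"
      using F G by (intro exI[of _ "F \<union> G"]) auto
  qed
  moreover have "?P (\<Union>\<K>)" if "\<forall>K\<in>\<K>. ?P K" for \<K>
  proof
    fix x assume "x \<in> \<Union>\<K>"
    then obtain K where K: "K \<in> \<K>" "x \<in> K" by blast
    have "\<exists>F\<subseteq>N. finite F \<and> (+) x ` \<Inter>F \<subseteq> K"
      using bspec[OF bspec[OF that K(1)] K(2)] .
    with K(1) show "\<exists>F\<subseteq>N. finite F \<and> (+) x ` \<Inter>F \<subseteq> \<Union>\<K>" by (meson Union_upper order_trans)
  qed
  ultimately have "istopology ?P" unfolding istopology_def by (intro conjI allI impI) simp_all
  then show ?thesis unfolding nbhd_topology_def by (simp add: topology_inverse')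
qed

definition gauge_topology :: "'a::real_vector set \<Rightarrow> 'a topology" where
  "gauge_topology C = nbhd_topology {(*\<^sub>R) t ` C | t. t \<noteq> 0}"

text \<open>The topology and the sigma-algebra are determined by \<open>C0\<close>; they are defined after the locale.
  Nonemptiness of \<open>C0\<close> is implicit in its being a fundamental system of neighbourhoods.\<close>

locale measurable_lcs =
  fixes C0 :: "'a::real_vector set set"
  assumes nonempty: "C0 \<noteq> {}"
    and internal: "\<And>C. C \<in> C0 \<Longrightarrow> internal_convex C"
    and symmetric: "\<And>C. C \<in> C0 \<Longrightarrow> uminus ` C = C"
    and separable: "\<And>C. C \<in> C0 \<Longrightarrow> separable_space (gauge_topology C)"
    and Int_closed: "\<And>A B. A \<in> C0 \<Longrightarrow> B \<in> C0 \<Longrightarrow> A \<inter> B \<in> C0"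
    and dilation_closed: "\<And>C t. C \<in> C0 \<Longrightarrow> t \<noteq> 0 \<Longrightarrow> (*\<^sub>R) t ` C \<in> C0"
    and Inter_C0: "\<Inter>C0 = {0}"

definition lcs_topology :: "'a::real_vector set set \<Rightarrow> 'a topology" where
  "lcs_topology C0 = nbhd_topology C0"

definition translates :: "'a::real_vector set set \<Rightarrow> 'a \<Rightarrow> 'a set set" where
  "translates C0 x = (\<lambda>C. (+) x ` C) ` C0"

definition lcs_sigma :: "'a::real_vector set set \<Rightarrow> 'a measure" where
  "lcs_sigma C0 = sigma UNIV (\<Union>x. translates C0 x)"

context measurable_lcs
begin

lemma finite_Inter_closed:
  assumes "finite F" "F \<noteq> {}" "F \<subseteq> C0" shows "\<Inter>F \<in> C0"
  using assms by (induction rule: finite_ne_induct) (auto intro: Int_closed)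

lemma openin_lcs_topology:
  "openin (lcs_topology C0) U \<longleftrightarrow> (\<forall>x\<in>U. \<exists>C\<in>C0. (+) x ` C \<subseteq> U)"
  unfolding lcs_topology_def openin_nbhd_topology
proof (intro ball_cong refl iffI)
  fix x
  assume "\<exists>F\<subseteq>C0. finite F \<and> (+) x ` \<Inter>F \<subseteq> U"
  then obtain F where F: "F \<subseteq> C0" "finite F" "(+) x ` \<Inter>F \<subseteq> U" by blast
  show "\<exists>C\<in>C0. (+) x ` C \<subseteq> U"
  proof (cases "F = {}")
    case True
    then show ?thesis using F(3) nonempty by (auto simp: image_subset_iff)
  next
    case False
    then show ?thesis using F finite_Inter_closed by blast
  qed
next
  fix x
  assume "\<exists>C\<in>C0. (+) x ` C \<subseteq> U"
  then obtain C where "C \<in> C0" "(+) x ` C \<subseteq> U" by blast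
  then show "\<exists>F\<subseteq>C0. finite F \<and> (+) x ` \<Inter>F \<subseteq> U"
    by (intro exI[of _ "{C}"]) auto
qed

lemma topspace_lcs_topology: "topspace (lcs_topology C0) = UNIV"
proof -
  have "openin (lcs_topology C0) UNIV"
    using nonempty by (auto simp: openin_lcs_topology)
  then show ?thesis using openin_subset by blast
qed

lemma openin_translate:
  assumes "C \<in> C0" shows "openin (lcs_topology C0) ((+) x ` C)"
  unfolding openin_lcs_topology
proof
  fix y assume "y \<in> (+) x ` C"
  then obtain z where z: "z \<in> C" "y = x + z" by blast
  have ic: "convex C" and eq: "C = {x. convex_gauge C x < 1}"
    using internal[OF assms] unfolding internal_convex_def by blast+
  have "convex_gauge C z < 1" using equalityD1[OF eq] z(1) by (rule set_mp[THEN CollectD])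
  then obtain t c where t: "0 \<le> t" "t < 1" "z = t *\<^sub>R c" "c \<in> C"
    unfolding convex_gauge_def Inf_less_iff by (auto simp: one_ereal_def) blast
  have "(+) y ` ((*\<^sub>R) (1 - t) ` C) \<subseteq> (+) x ` C"
  proof
    fix w assume "w \<in> (+) y ` ((*\<^sub>R) (1 - t) ` C)"
    then obtain d where d: "d \<in> C" "w = y + (1 - t) *\<^sub>R d" by blast
    have "t *\<^sub>R c + (1 - t) *\<^sub>R d \<in> C"
      using convexD[OF ic t(4) d(1), of t "1 - t"] t by simp
    then show "w \<in> (+) x ` C" using d z t by (auto simp: add.assoc)
  qed
  then show "\<exists>D\<in>C0. (+) y ` D \<subseteq> (+) x ` C"
    using dilation_closed[OF assms, of "1 - t"] t by auto
qed

lemma Hausdorff_lcs_topology: "Hausdorff_space (lcs_topology C0)"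
  unfolding Hausdorff_space_def topspace_lcs_topology
proof (intro allI impI, elim conjE)
  fix x y :: 'a assume "x \<noteq> y"
  then have "x - y \<notin> \<Inter>C0" by (simp add: Inter_C0)
  then obtain C where C: "C \<in> C0" "x - y \<notin> C" by blast
  have ic: "convex C" "0 \<in> C"
    using internal[OF C(1)] unfolding internal_convex_def by blast+
  define H where "H = (*\<^sub>R) (1/2) ` C"
  have H: "H \<in> C0" "0 \<in> H"
    using dilation_closed[OF C(1), of "1/2"] ic(2) by (auto simp: H_def image_iff)
  have "(+) x ` H \<inter> (+) y ` H = {}"
  proof (rule ccontr)
    assume "(+) x ` H \<inter> (+) y ` H \<noteq> {}"
    then obtain a b where ab: "a \<in> C" "b \<in> C" "x + (1/2) *\<^sub>R a = y + (1/2) *\<^sub>R b"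
      by (auto simp: H_def)
    have "- a \<in> C" using symmetric[OF C(1)] ab(1) by blast
    then have "(1/2) *\<^sub>R b + (1/2) *\<^sub>R (- a) \<in> C"
      using convexD[OF ic(1) ab(2), of "- a" "1/2" "1/2"] by simp
    moreover have "(1/2) *\<^sub>R b + (1/2) *\<^sub>R (- a) = x - y"
      using ab(3) by (simp add: algebra_simps)
    ultimately show False using C(2) by simp
  qed
  moreover have "x \<in> (+) x ` H" "y \<in> (+) y ` H"
    using H(2) by (metis add.right_neutral image_eqI)+
  ultimately show "\<exists>U V. openin (lcs_topology C0) U \<and> openin (lcs_topology C0) V \<and>
      x \<in> U \<and> y \<in> V \<and> disjnt U V"
    using openin_translate[OF H(1)] unfolding disjnt_def by blast
qed

end

text \<open>Addition on \<open>ereal\<close> satisfies \<open>-\<infinity> + \<infinity> = \<infinity>\<close>, and multiplication on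
  \<open>ennreal\<close> satisfies \<open>\<infinity> * 0 = 0\<close>; both conventions are relied upon.\<close>

definition upper_semicontinuous :: "'a topology \<Rightarrow> ('a \<Rightarrow> ereal) \<Rightarrow> bool" where
  "upper_semicontinuous T f \<longleftrightarrow> (\<forall>t. openin T {x. f x < t})"

definition usc_envelope :: "'a topology \<Rightarrow> ('a \<Rightarrow> ereal) \<Rightarrow> ('a \<Rightarrow> ereal)" where
  "usc_envelope T f = (LEAST g. upper_semicontinuous T g \<and> f \<le> g)"

lemma usc_envelope_eq_Inf:
  assumes "topspace T = UNIV"
  shows "usc_envelope T f = Inf {g. upper_semicontinuous T g \<and> f \<le> g}" (is "_ = Inf ?G")
  unfolding usc_envelope_def
proof (rule Least_equality)
  have "{x. Inf ?G x < t} = (\<Union>g\<in>?G. {x. g x < t})" for t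
    by (auto simp: Inf_less_iff Inf_apply INF_less_iff)
  moreover have "openin T (\<Union>g\<in>?G. {x. g x < t})" for t
    by (rule openin_Union) (auto simp: upper_semicontinuous_def)
  ultimately show "upper_semicontinuous T (Inf ?G) \<and> f \<le> Inf ?G"
    by (auto simp: upper_semicontinuous_def intro: Inf_greatest)
qed (auto intro: Inf_lower)

definition ext_exp :: "ereal \<Rightarrow> ennreal" where
  "ext_exp a = (if a = \<infinity> then \<infinity> else if a = -\<infinity> then 0 else ennreal (exp (real_of_ereal a)))"

definition ext_ln :: "ennreal \<Rightarrow> ereal" where
  "ext_ln a = (if a = \<infinity> then \<infinity> else if a = 0 then -\<infinity> else ereal (ln (enn2real a)))"

text \<open>\<open>D\<close> need not be measurable.\<close>

definition carried_by :: "'a measure \<Rightarrow> 'a set \<Rightarrow> bool" where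
  "carried_by \<mu> D \<longleftrightarrow>
     (\<forall>A\<in>sets \<mu>. \<forall>B\<in>sets \<mu>. A \<inter> D = B \<inter> D \<longrightarrow> emeasure \<mu> A = emeasure \<mu> B)"

definition relatively_compact :: "'a topology \<Rightarrow> 'a set \<Rightarrow> bool" where
  "relatively_compact T S \<longleftrightarrow> (\<exists>Q. compactin T Q \<and> S \<subseteq> Q)"

definition iid_sequence :: "'b measure \<Rightarrow> 'a measure \<Rightarrow> (nat \<Rightarrow> 'b \<Rightarrow> 'a) \<Rightarrow> bool" where
  "iid_sequence P \<mu> X \<longleftrightarrow>
     prob_space.indep_vars P (\<lambda>_. \<mu>) X {1..} \<and> (\<forall>n\<ge>1. distr P \<mu> (X n) = \<mu>)"

definition sample_mean :: "(nat \<Rightarrow> 'b \<Rightarrow> 'a::real_vector) \<Rightarrow> nat \<Rightarrow> 'b \<Rightarrow> 'a" where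
  "sample_mean X n \<omega> = (1 / real n) *\<^sub>R (\<Sum>k=1..n. X k \<omega>)"

definition entropy_of ::
    "'a::real_vector set set \<Rightarrow> (nat \<Rightarrow> 'a measure) \<Rightarrow> 'a \<Rightarrow> ereal" where
  "entropy_of C0 \<nu> x =
     (INF C\<in>translates C0 x. liminf (\<lambda>n. ereal (1 / real n) * ext_ln (emeasure (\<nu> n) C)))"

end

theory Submission
  imports Defs
begin

text \<open>By convexity, splitting \<open>n = qN + r\<close> summands into \<open>q\<close> blocks of length \<open>N\<close> and a remainder
  gives \<open>P(mean n \<in> x + C) \<ge> P(mean N \<in> x + C/2) ^ q * P(S r - r x \<in> t C)\<close> with \<open>t \<ge> n/2\<close>, and the
  last factor is eventually at least 1/2. Hence \<open>s x < b\<close> yields a neighbourhood of \<open>x\<close> which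
  carries \<open>mean n\<close> with probability at most \<open>exp (n b)\<close> for every \<open>n\<close>, although \<open>s\<close> is defined by
  a liminf. Finitely many such neighbourhoods, on each of which \<open>f < a\<close> for some \<open>a\<close> close to the
  envelope of \<open>f\<close>, cover the compact closure of \<open>K \<inter> D\<close>; the part of \<open>K\<close> outside them misses \<open>D\<close>
  and is null for the law of \<open>mean n\<close>, since by convexity that law is again carried by \<open>D\<close>.\<close>

context measurable_lcs
begin

section \<open>Convexity and dilations of the basic neighbourhoods\<close>

lemma C0_convex: "C \<in> C0 \<Longrightarrow> convex C"
  and C0_zero: "C \<in> C0 \<Longrightarrow> 0 \<in> C"
  using internal unfolding internal_convex_def by blast+

lemma C0_uminus: "C \<in> C0 \<Longrightarrow> x \<in> C \<Longrightarrow> - x \<in> C"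
  using symmetric by blast

lemma C0_absorbing:
  assumes "C \<in> C0" obtains t where "0 \<le> t" "x \<in> (*\<^sub>R) t ` C"
proof -
  have "convex_gauge C x < \<infinity>"
    using internal[OF assms] unfolding internal_convex_def by blast
  then show ?thesis
    using that unfolding convex_gauge_def Inf_less_iff by blast
qed

text \<open>The equality \<open>C = {x. convex_gauge C x < 1}\<close> is what makes gauge balls
  open: each point of \<open>C\<close> already lies in a strictly smaller dilate, which leaves room
  \<open>1 - t\<close> around it.\<close>

lemma C0_shrink:
  assumes "C \<in> C0" "x \<in> C" obtains t where "0 \<le> t" "t < 1" "x \<in> (*\<^sub>R) t ` C"
proof -
  have "C = {x. convex_gauge C x < 1}"
    using internal[OF assms(1)] unfolding internal_convex_def by blast
  with assms(2) have "convex_gauge C x < 1" by blast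
  then obtain t where "0 \<le> t" "ereal t < 1" "x \<in> (*\<^sub>R) t ` C"
    unfolding convex_gauge_def Inf_less_iff by blast
  then show ?thesis using that by simp
qed

text \<open>Triangle inequality for the gauge, phrased with dilates so that no infimum has to be
  attained. It is convexity with weights \<open>s / (s + t)\<close> and
  \<open>t / (s + t)\<close>.\<close>

lemma dilation_add:
  assumes "C \<in> C0" "0 \<le> s" "0 \<le> t" "x \<in> (*\<^sub>R) s ` C" "y \<in> (*\<^sub>R) t ` C"
  shows "x + y \<in> (*\<^sub>R) (s + t) ` C"
proof (cases "s + t = 0")
  case True
  with assms(2,3) have "s = 0" "t = 0" by auto
  then show ?thesis using assms(4,5) by auto
next
  case False
  obtain a b where ab: "a \<in> C" "b \<in> C" "x = s *\<^sub>R a" "y = t *\<^sub>R b"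
    using assms(4,5) by blast
  have "(s / (s + t)) *\<^sub>R a + (t / (s + t)) *\<^sub>R b \<in> C"
    using convexD[OF C0_convex[OF assms(1)] ab(1,2), of "s / (s + t)" "t / (s + t)"] assms(2,3) False
    by (simp add: add_divide_distrib[symmetric])
  moreover have "x + y = (s + t) *\<^sub>R ((s / (s + t)) *\<^sub>R a + (t / (s + t)) *\<^sub>R b)"
    using False ab by (simp add: scaleR_add_right)
  ultimately show ?thesis by blast
qed

lemma dilation_mono:
  assumes "C \<in> C0" "0 \<le> s" "s \<le> t"
  shows "(*\<^sub>R) s ` C \<subseteq> (*\<^sub>R) t ` C"
proof
  fix x assume "x \<in> (*\<^sub>R) s ` C"
  moreover have "0 \<in> (*\<^sub>R) (t - s) ` C"
    using imageI[OF C0_zero[OF assms(1)], of "(*\<^sub>R) (t - s)"] by simp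
  ultimately show "x \<in> (*\<^sub>R) t ` C"
    using dilation_add[OF assms(1), of s "t - s" x 0] assms(2,3) by simp
qed

lemma translate_mem_iff: "y \<in> (+) x ` C \<longleftrightarrow> y - x \<in> C" for x y :: 'a
  by (auto simp: image_iff) (metis add_diff_cancel_left' diff_add_cancel add.commute)

lemma dilation_mem_iff:
  fixes y :: 'a
  assumes "t \<noteq> 0" shows "y \<in> (*\<^sub>R) t ` C \<longleftrightarrow> (1 / t) *\<^sub>R y \<in> C"
proof
  assume "(1 / t) *\<^sub>R y \<in> C"
  then have "t *\<^sub>R ((1 / t) *\<^sub>R y) \<in> (*\<^sub>R) t ` C" by blast
  then show "y \<in> (*\<^sub>R) t ` C" using assms by simp
qed (use assms in auto)

section \<open>Gauge topologies and their countable dense sets\<close>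

lemma openin_gauge_topology_translate:
  assumes "C \<in> C0" "0 < r"
  shows "openin (gauge_topology C) ((+) x ` ((*\<^sub>R) r ` C))"
  unfolding gauge_topology_def openin_nbhd_topology
proof
  fix y assume "y \<in> (+) x ` ((*\<^sub>R) r ` C)"
  then have "y - x \<in> (*\<^sub>R) r ` C" by (simp only: translate_mem_iff)
  then obtain c where c: "c \<in> C" "y - x = r *\<^sub>R c" by blast
  \<comment> \<open>Since \<open>y\<close> lies in the smaller ball of radius \<open>r * t\<close>,
    the dilate by \<open>r * (1 - t)\<close> can be added without leaving the ball of radius
    \<open>r\<close>.\<close>
  obtain t where t: "0 \<le> t" "t < 1" "c \<in> (*\<^sub>R) t ` C" using C0_shrink[OF assms(1) c(1)] .
  have y: "y - x \<in> (*\<^sub>R) (r * t) ` C" using t(3) c(2) by auto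
  have "(+) y ` ((*\<^sub>R) (r * (1 - t)) ` C) \<subseteq> (+) x ` ((*\<^sub>R) r ` C)"
  proof
    fix w assume "w \<in> (+) y ` ((*\<^sub>R) (r * (1 - t)) ` C)"
    then have w: "w - y \<in> (*\<^sub>R) (r * (1 - t)) ` C" by (simp only: translate_mem_iff)
    have "(y - x) + (w - y) \<in> (*\<^sub>R) (r * t + r * (1 - t)) ` C"
      by (rule dilation_add[OF assms(1) _ _ y w]) (use t assms(2) in auto)
    then have "w - x \<in> (*\<^sub>R) r ` C" by (simp add: algebra_simps)
    then show "w \<in> (+) x ` ((*\<^sub>R) r ` C)" by (simp only: translate_mem_iff)
  qed
  moreover have "(*\<^sub>R) (r * (1 - t)) ` C \<in> {(*\<^sub>R) t ` C | t. t \<noteq> 0}"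
    using assms(2) t(2) by force
  ultimately show "\<exists>F\<subseteq>{(*\<^sub>R) t ` C | t. t \<noteq> 0}. finite F \<and> (+) y ` \<Inter>F \<subseteq> (+) x ` ((*\<^sub>R) r ` C)"
    by (intro exI[of _ "{(*\<^sub>R) (r * (1 - t)) ` C}"]) auto
qed

lemma topspace_gauge_topology: "topspace (gauge_topology C) = (UNIV :: 'a set)"
proof -
  have "openin (gauge_topology C) (UNIV :: 'a set)"
    unfolding gauge_topology_def openin_nbhd_topology
    by (auto intro!: exI[of _ "{}"])
  then show ?thesis using openin_subset by blast
qed

text \<open>The form in which separability is used: balls are open in the gauge topology, so one
  countable set approximates every point at every scale.\<close>

lemma gauge_dense_sequence:
  assumes "C \<in> C0"
  obtains U where "countable U"
    and "\<And>x r. 0 < r \<Longrightarrow> \<exists>d\<in>U. d - x \<in> (*\<^sub>R) r ` C"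
proof -
  obtain U where U: "countable U" "(gauge_topology C) closure_of U = UNIV"
    using separable[OF assms] unfolding separable_space_def topspace_gauge_topology by blast
  have "\<exists>d\<in>U. d - x \<in> (*\<^sub>R) r ` C" if r: "0 < r" for x :: 'a and r
  proof -
    have "x \<in> (+) x ` ((*\<^sub>R) r ` C)"
      unfolding translate_mem_iff using imageI[OF C0_zero[OF assms], of "(*\<^sub>R) r"] by simp
    moreover have "\<forall>T. x \<in> T \<and> openin (gauge_topology C) T \<longrightarrow> (\<exists>d. d \<in> U \<and> d \<in> T)"
      using U(2) by (metis UNIV_I in_closure_of)
    ultimately obtain d where "d \<in> U" "d \<in> (+) x ` ((*\<^sub>R) r ` C)"
      using openin_gauge_topology_translate[OF assms r, of x] by meson
    then show ?thesis unfolding translate_mem_iff by blast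
  qed
  with U(1) show ?thesis using that by blast
qed

section \<open>Measurability of the vector space operations\<close>

lemma space_lcs_sigma: "space (lcs_sigma C0) = UNIV"
  unfolding lcs_sigma_def by (simp add: space_measure_of)

lemma translate_in_lcs_sigma:
  assumes "C \<in> C0" shows "(+) x ` C \<in> sets (lcs_sigma C0)"
  using assms unfolding lcs_sigma_def translates_def by (auto intro!: sigma_sets.Basic)

lemma measurable_lcs_sigmaI:
  assumes "\<And>C x. C \<in> C0 \<Longrightarrow> {\<omega> \<in> space M. g \<omega> - x \<in> C} \<in> sets M"
  shows "g \<in> measurable M (lcs_sigma C0)"
  unfolding lcs_sigma_def
proof (rule measurable_measure_of)
  fix A assume "A \<in> (\<Union>x. translates C0 x)"
  then obtain x C where "C \<in> C0" "A = (+) x ` C" unfolding translates_def by blast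
  moreover have "g -` ((+) x ` C) \<inter> space M = {\<omega> \<in> space M. g \<omega> - x \<in> C}"
    unfolding vimage_def translate_mem_iff by auto
  ultimately show "g -` A \<inter> space M \<in> sets M" using assms by simp
qed auto

text \<open>The preimage of an open gauge ball is a countable union of rectangles, centred at a
  countable \<open>\<tau>\<^sub>C\<close>-dense set; this is where separability enters.\<close>

lemma measurable_lcs_add_pair:
  "(\<lambda>(x, y). x + y) \<in> measurable (lcs_sigma C0 \<Otimes>\<^sub>M lcs_sigma C0) (lcs_sigma C0)"
proof (rule measurable_lcs_sigmaI)
  fix C z assume C: "C \<in> C0"
  obtain U where U: "countable U" "\<And>x r. 0 < r \<Longrightarrow> \<exists>d\<in>U. d - x \<in> (*\<^sub>R) r ` C"
    using gauge_dense_sequence[OF C] by blast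
  define Q where "Q = \<rat> \<inter> {0<..<1::real}"
  define R where "R = (\<lambda>d r. ((+) d ` ((*\<^sub>R) r ` C)) \<times> ((+) (z - d) ` ((*\<^sub>R) (1 - r) ` C)))"
  have "{w \<in> space (lcs_sigma C0 \<Otimes>\<^sub>M lcs_sigma C0). (case w of (x, y) \<Rightarrow> x + y) - z \<in> C}
     = (\<Union>d\<in>U. \<Union>r\<in>Q. R d r)" (is "?L = ?R")
  proof
    show "?L \<subseteq> ?R"
    proof
      fix w assume "w \<in> ?L"
      then obtain x y where w: "w = (x, y)" and xy: "x + y - z \<in> C" by (cases w) auto
      obtain t where t: "0 \<le> t" "t < 1" "x + y - z \<in> (*\<^sub>R) t ` C" using C0_shrink[OF C xy] .
      \<comment> \<open>The bound gives \<open>t + r < 1 - r\<close>: moving the centre to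
        \<open>d\<close> costs at most \<open>r\<close> in each coordinate, and the two radii
        \<open>r\<close> and \<open>1 - r\<close> still add up to 1.\<close>
      obtain r where r: "r \<in> \<rat>" "0 < r" "r < (1 - t) / 2"
        using Rats_dense_in_real[of 0 "(1 - t) / 2"] t(2) by auto
      obtain d where d: "d \<in> U" "d - x \<in> (*\<^sub>R) r ` C" using U(2)[OF r(2)] by blast
      have "(x + y - z) + (d - x) \<in> (*\<^sub>R) (t + r) ` C"
        by (rule dilation_add[OF C _ _ t(3) d(2)]) (use t r in auto)
      then have "y - (z - d) \<in> (*\<^sub>R) (t + r) ` C" by (simp add: algebra_simps)
      moreover have "(*\<^sub>R) (t + r) ` C \<subseteq> (*\<^sub>R) (1 - r) ` C"
        by (rule dilation_mono[OF C]) (use t r in auto)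
      moreover have "x - d \<in> (*\<^sub>R) r ` C"
        using C0_uminus[OF dilation_closed[OF C, of r] d(2)] r(2) by simp
      ultimately have "w \<in> R d r" unfolding R_def w mem_Times_iff fst_conv snd_conv translate_mem_iff
        by blast
      moreover have "r \<in> Q" unfolding Q_def using r t by auto
      ultimately show "w \<in> ?R" using d(1) by blast
    qed
  next
    show "?R \<subseteq> ?L"
    proof
      fix w assume "w \<in> ?R"
      then obtain d r where dr: "r \<in> Q" "w \<in> R d r" by blast
      obtain x y where w: "w = (x, y)" by fastforce
      have "x - d \<in> (*\<^sub>R) r ` C" "y - (z - d) \<in> (*\<^sub>R) (1 - r) ` C"
        using dr(2) unfolding R_def w mem_Times_iff fst_conv snd_conv translate_mem_iff by auto
      then have "(x - d) + (y - (z - d)) \<in> (*\<^sub>R) (r + (1 - r)) ` C"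
        by (rule dilation_add[OF C, rotated 2]) (use dr(1) in \<open>auto simp: Q_def\<close>)
      then have "x + y - z \<in> C" by (simp add: algebra_simps)
      then show "w \<in> ?L" by (simp add: w space_pair_measure space_lcs_sigma)
    qed
  qed
  moreover have "?R \<in> sets (lcs_sigma C0 \<Otimes>\<^sub>M lcs_sigma C0)"
  proof (intro sets.countable_UN'' U(1))
    show "countable Q" unfolding Q_def using countable_rat by blast
    show "R d r \<in> sets (lcs_sigma C0 \<Otimes>\<^sub>M lcs_sigma C0)" if "r \<in> Q" for d r
      unfolding R_def using that
      by (intro pair_measureI translate_in_lcs_sigma dilation_closed C) (auto simp: Q_def)
  qed
  ultimately show "?L \<in> sets (lcs_sigma C0 \<Otimes>\<^sub>M lcs_sigma C0)" by simp
qed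

lemma measurable_lcs_add [measurable]:
  assumes [measurable]: "g \<in> measurable M (lcs_sigma C0)" "h \<in> measurable M (lcs_sigma C0)"
  shows "(\<lambda>\<omega>. g \<omega> + h \<omega>) \<in> measurable M (lcs_sigma C0)"
  using measurable_compose[OF measurable_Pair[OF assms] measurable_lcs_add_pair] by simp

lemma measurable_lcs_const [measurable]: "(\<lambda>_. c) \<in> measurable M (lcs_sigma C0)"
  by (rule measurable_const) (simp add: space_lcs_sigma)

lemma measurable_lcs_sum [measurable]:
  assumes "\<And>k. k \<in> I \<Longrightarrow> g k \<in> measurable M (lcs_sigma C0)"
  shows "(\<lambda>\<omega>. \<Sum>k\<in>I. g k \<omega>) \<in> measurable M (lcs_sigma C0)"
  using assms by (induction I rule: infinite_finite_induct) auto

lemma measurable_lcs_scaleR [measurable]: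
  "(\<lambda>y. t *\<^sub>R y) \<in> measurable (lcs_sigma C0) (lcs_sigma C0)"
proof (cases "t = 0")
  case False
  show ?thesis
  proof (rule measurable_lcs_sigmaI)
    fix C x assume C: "C \<in> C0"
    have "{\<omega> \<in> space (lcs_sigma C0). t *\<^sub>R \<omega> - x \<in> C} = (+) ((1 / t) *\<^sub>R x) ` ((*\<^sub>R) (1 / t) ` C)"
      using False
      by (intro set_eqI)
        (simp add: translate_mem_iff dilation_mem_iff space_lcs_sigma scaleR_diff_right)
    then show "{\<omega> \<in> space (lcs_sigma C0). t *\<^sub>R \<omega> - x \<in> C} \<in> sets (lcs_sigma C0)"
      using translate_in_lcs_sigma[OF dilation_closed[OF C]] False by simp
  qed
qed simp

end

section \<open>Laws of the partial sums\<close>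

locale lcs_prob_space = measurable_lcs C0 + prob_space \<mu>
  for C0 :: "'a::real_vector set set" and \<mu> :: "'a measure" +
  assumes sets_eq_lcs [measurable_cong]: "sets \<mu> = sets (lcs_sigma C0)"
begin

text \<open>Built on the product space rather than from a given i.i.d. sequence, so that convolution
  identities follow from Fubini. For \<open>n = 0\<close> it is the Dirac mass at 0, which serves as
  the empty remainder of a division.\<close>

definition sum_law :: "nat \<Rightarrow> 'a measure" where
  "sum_law n = distr (PiM {1..n} (\<lambda>_. \<mu>)) (lcs_sigma C0) (\<lambda>x. \<Sum>k\<in>{1..n}. x k)"

lemma space_eq_UNIV: "space \<mu> = UNIV"
  using sets_eq_imp_space_eq[OF sets_eq_lcs] by (simp add: space_lcs_sigma)

lemma measurable_sum_PiM [measurable]: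
  "(\<lambda>x. \<Sum>k\<in>I. x k) \<in> measurable (PiM I (\<lambda>_. \<mu>)) (lcs_sigma C0)"
proof (rule measurable_lcs_sum)
  fix k assume "k \<in> I"
  then show "(\<lambda>x. x k) \<in> measurable (PiM I (\<lambda>_. \<mu>)) (lcs_sigma C0)"
    using measurable_component_singleton[of k I "\<lambda>_. \<mu>"] measurable_cong_sets[OF refl sets_eq_lcs]
    by simp
qed

lemma sets_sum_law [simp, measurable_cong]: "sets (sum_law n) = sets (lcs_sigma C0)"
  and space_sum_law [simp]: "space (sum_law n) = UNIV"
  by (simp_all add: sum_law_def space_lcs_sigma)

lemma prob_space_sum_law: "prob_space (sum_law n)"
  unfolding sum_law_def
  by (intro prob_space.prob_space_distr prob_space_PiM measurable_sum_PiM prob_space_axioms)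

lemma nn_integral_sum_law_0:
  assumes [measurable]: "g \<in> borel_measurable (lcs_sigma C0)"
  shows "(\<integral>\<^sup>+x. g x \<partial>sum_law 0) = g 0"
  unfolding sum_law_def
  by (subst nn_integral_distr) (simp_all add: PiM_empty nn_integral_count_space_finite space_lcs_sigma)

lemma nn_integral_sum_law_Suc:
  assumes [measurable]: "g \<in> borel_measurable (lcs_sigma C0)"
  shows "(\<integral>\<^sup>+x. g x \<partial>sum_law (Suc n)) = (\<integral>\<^sup>+x. \<integral>\<^sup>+y. g (x + y) \<partial>\<mu> \<partial>sum_law n)"
proof -
  interpret product_sigma_finite "\<lambda>_. \<mu>"
    by (intro product_sigma_finite.intro prob_space_imp_sigma_finite prob_space_axioms)
  have I: "{1..Suc n} = insert (Suc n) {1..n}" by auto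
  have "(\<integral>\<^sup>+x. g x \<partial>sum_law (Suc n)) = (\<integral>\<^sup>+x. g (\<Sum>k\<in>{1..Suc n}. x k) \<partial>PiM {1..Suc n} (\<lambda>_. \<mu>))"
    unfolding sum_law_def by (subst nn_integral_distr) simp_all
  also have "\<dots> = (\<integral>\<^sup>+x. \<integral>\<^sup>+y. g (\<Sum>k\<in>{1..Suc n}. (x(Suc n := y)) k) \<partial>\<mu> \<partial>PiM {1..n} (\<lambda>_. \<mu>))"
    unfolding I by (subst product_nn_integral_insert) simp_all
  also have "\<dots> = (\<integral>\<^sup>+x. \<integral>\<^sup>+y. g ((\<Sum>k\<in>{1..n}. x k) + y) \<partial>\<mu> \<partial>PiM {1..n} (\<lambda>_. \<mu>))"
    unfolding I by (auto intro!: nn_integral_cong arg_cong[of _ _ g] sum.cong simp: add.commute)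
  also have "\<dots> = (\<integral>\<^sup>+x. \<integral>\<^sup>+y. g (x + y) \<partial>\<mu> \<partial>sum_law n)"
    unfolding sum_law_def by (subst nn_integral_distr) simp_all
  finally show ?thesis .
qed

text \<open>The law of a sum of \<open>n + m\<close> terms is a convolution: single summands are
  split off one at a time. \<open>g\<close> varies in the induction because the hypothesis is
  applied to the integral of \<open>g (w + y)\<close> over \<open>y\<close>.\<close>

lemma nn_integral_sum_law_add:
  assumes "g \<in> borel_measurable (lcs_sigma C0)"
  shows "(\<integral>\<^sup>+x. g x \<partial>sum_law (n + m)) = (\<integral>\<^sup>+x. \<integral>\<^sup>+y. g (x + y) \<partial>sum_law m \<partial>sum_law n)"
  using assms
proof (induction m arbitrary: g)
  case 0
  note [measurable] = 0
  show ?case by (simp add: nn_integral_sum_law_0)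
next
  case (Suc m)
  note [measurable] = Suc.prems
  have "(\<integral>\<^sup>+x. g x \<partial>sum_law (n + Suc m)) = (\<integral>\<^sup>+w. \<integral>\<^sup>+y. g (w + y) \<partial>\<mu> \<partial>sum_law (n + m))"
    by (simp add: nn_integral_sum_law_Suc)
  also have "\<dots> = (\<integral>\<^sup>+x. \<integral>\<^sup>+z. \<integral>\<^sup>+y. g (x + z + y) \<partial>\<mu> \<partial>sum_law m \<partial>sum_law n)"
    by (rule Suc.IH) measurable
  also have "\<dots> = (\<integral>\<^sup>+x. \<integral>\<^sup>+z. g (x + z) \<partial>sum_law (Suc m) \<partial>sum_law n)"
    by (subst nn_integral_sum_law_Suc) (simp_all add: add.assoc)
  finally show ?case .
qed

text \<open>Disjoint blocks of summands are independent: integrate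
  \<open>indicator A x * indicator B y \<le> indicator E (x + y)\<close> against the product of the
  two laws.\<close>

lemma sum_law_superadditive:
  assumes [measurable]: "A \<in> sets (lcs_sigma C0)" "B \<in> sets (lcs_sigma C0)" "E \<in> sets (lcs_sigma C0)"
    and "\<And>x y. x \<in> A \<Longrightarrow> y \<in> B \<Longrightarrow> x + y \<in> E"
  shows "measure (sum_law n) A * measure (sum_law m) B \<le> measure (sum_law (n + m)) E"
proof -
  interpret n: prob_space "sum_law n" by (rule prob_space_sum_law)
  interpret m: prob_space "sum_law m" by (rule prob_space_sum_law)
  interpret nm: prob_space "sum_law (n + m)" by (rule prob_space_sum_law)
  have "emeasure (sum_law n) A * emeasure (sum_law m) B
      = (\<integral>\<^sup>+x. \<integral>\<^sup>+y. indicator A x * indicator B y \<partial>sum_law m \<partial>sum_law n)"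
    by (simp add: nn_integral_cmult nn_integral_multc)
  also have "\<dots> \<le> (\<integral>\<^sup>+x. \<integral>\<^sup>+y. indicator E (x + y) \<partial>sum_law m \<partial>sum_law n)"
    using assms(4) by (intro nn_integral_mono) (auto simp: indicator_def)
  also have "\<dots> = emeasure (sum_law (n + m)) E"
    by (subst nn_integral_sum_law_add[symmetric]) simp_all
  finally have "ennreal (measure (sum_law n) A * measure (sum_law m) B)
      \<le> ennreal (measure (sum_law (n + m)) E)"
    by (simp add: n.emeasure_eq_measure m.emeasure_eq_measure nm.emeasure_eq_measure ennreal_mult)
  then show ?thesis by simp
qed

section \<open>Superadditivity of centred probabilities\<close>

text \<open>The probability that the sum of \<open>n\<close> terms, minus \<open>n\<close> times
  \<open>x\<close>, lies in \<open>t\<close> times \<open>C\<close>. The radius is not divided by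
  \<open>n\<close>, so radii simply add when blocks are concatenated.\<close>

definition centred_prob :: "'a set \<Rightarrow> 'a \<Rightarrow> nat \<Rightarrow> real \<Rightarrow> real" where
  "centred_prob C x n t = measure (sum_law n) ((+) (real n *\<^sub>R x) ` ((*\<^sub>R) t ` C))"

lemma translate_dilation_sets [measurable]:
  "C \<in> C0 \<Longrightarrow> 0 < t \<Longrightarrow> (+) x ` ((*\<^sub>R) t ` C) \<in> sets (lcs_sigma C0)"
  by (intro translate_in_lcs_sigma dilation_closed) auto

lemma centred_prob_mono:
  assumes "C \<in> C0" "0 < s" "s \<le> t"
  shows "centred_prob C x n s \<le> centred_prob C x n t"
proof -
  interpret n: prob_space "sum_law n" by (rule prob_space_sum_law)
  show ?thesis
    unfolding centred_prob_def using assms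
    by (intro n.finite_measure_mono image_mono dilation_mono) simp_all
qed

lemma centred_prob_superadditive:
  assumes C: "C \<in> C0" and "0 < s" "0 < t"
  shows "centred_prob C x n s * centred_prob C x m t \<le> centred_prob C x (n + m) (s + t)"
  unfolding centred_prob_def
proof (rule sum_law_superadditive)
  fix a b assume "a \<in> (+) (real n *\<^sub>R x) ` (*\<^sub>R) s ` C" "b \<in> (+) (real m *\<^sub>R x) ` (*\<^sub>R) t ` C"
  then have "(a - real n *\<^sub>R x) + (b - real m *\<^sub>R x) \<in> (*\<^sub>R) (s + t) ` C"
    unfolding translate_mem_iff by (intro dilation_add) (use assms in auto)
  moreover have "(a - real n *\<^sub>R x) + (b - real m *\<^sub>R x) = a + b - real (n + m) *\<^sub>R x"
    by (simp add: algebra_simps)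
  ultimately show "a + b \<in> (+) (real (n + m) *\<^sub>R x) ` (*\<^sub>R) (s + t) ` C"
    unfolding translate_mem_iff by simp
qed (use assms in simp_all)

lemma centred_prob_power:
  assumes C: "C \<in> C0" and "0 < s" "0 < t"
  shows "centred_prob C x N s ^ q * centred_prob C x r t
    \<le> centred_prob C x (q * N + r) (real q * s + t)"
proof (induction q)
  case (Suc q)
  have "centred_prob C x N s ^ Suc q * centred_prob C x r t
      \<le> centred_prob C x N s * centred_prob C x (q * N + r) (real q * s + t)"
    using mult_left_mono[OF Suc, of "centred_prob C x N s"]
    by (simp add: mult.assoc centred_prob_def)
  also have "\<dots> \<le> centred_prob C x (N + (q * N + r)) (s + (real q * s + t))"
    using assms by (intro centred_prob_superadditive) (auto intro: add_nonneg_pos)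
  finally show ?case by (simp add: algebra_simps)
qed simp

text \<open>\<open>C\<close> is absorbing, so its dilates increase to the whole space; then
  continuity from below applies.\<close>

lemma centred_prob_tendsto_1:
  assumes C: "C \<in> C0"
  shows "(\<lambda>k. centred_prob C x n (real (Suc k))) \<longlonglongrightarrow> 1"
proof -
  interpret n: prob_space "sum_law n" by (rule prob_space_sum_law)
  let ?A = "\<lambda>k. (+) (real n *\<^sub>R x) ` ((*\<^sub>R) (real (Suc k)) ` C)"
  have "y \<in> (\<Union>k. ?A k)" for y
  proof -
    obtain t where t: "0 \<le> t" "y - real n *\<^sub>R x \<in> (*\<^sub>R) t ` C" using C0_absorbing[OF C] .
    obtain k where "t \<le> real k" using real_arch_simple by blast
    then have "(*\<^sub>R) t ` C \<subseteq> (*\<^sub>R) (real (Suc k)) ` C"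
      by (intro dilation_mono[OF C]) (use t in auto)
    with t(2) show ?thesis unfolding UN_iff translate_mem_iff by blast
  qed
  then have "(\<Union>k. ?A k) = UNIV" by blast
  moreover have "(\<lambda>k. measure (sum_law n) (?A k)) \<longlonglongrightarrow> measure (sum_law n) (\<Union>k. ?A k)"
  proof (rule n.finite_Lim_measure_incseq)
    show "range ?A \<subseteq> sets (sum_law n)"
      using translate_dilation_sets[OF C] by auto
    show "incseq ?A"
      unfolding incseq_def by (intro allI impI image_mono dilation_mono[OF C]) auto
  qed
  ultimately show ?thesis using n.prob_space by (simp add: centred_prob_def)
qed

text \<open>A Fekete-type argument by contradiction. If the probability \<open>c\<close> at time
  \<open>N\<close> exceeds \<open>exp (real N * b)\<close>, concatenating blocks of radius
  \<open>N / 2\<close> uses at most half of the radius \<open>n\<close> allowed at time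
  \<open>n\<close>, and the other half absorbs the remainder. The liminf is then at least
  \<open>ln c / real N\<close>, which exceeds \<open>b\<close>.\<close>

lemma liminf_mean_bound:
  assumes C: "C \<in> C0" and N: "N \<ge> 1"
    and less: "liminf (\<lambda>n. ereal (1 / real n) * ext_ln (ennreal (centred_prob C x n (real n)))) < ereal b"
  shows "centred_prob C x N (real N / 2) \<le> exp (real N * b)"
proof (rule ccontr)
  define c where "c = centred_prob C x N (real N / 2)"
  assume "\<not> centred_prob C x N (real N / 2) \<le> exp (real N * b)"
  then have c: "exp (real N * b) < c" by (simp add: c_def)
  then have c_pos: "0 < c" using less_trans[OF exp_gt_zero] by blast
  have "c \<le> 1"
    unfolding c_def centred_prob_def
    using prob_space.prob_le_1[OF prob_space_sum_law] by blast
  then have ln_c: "ln c \<le> 0" using c_pos by simp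
  have b: "b < ln c / real N"
    using c c_pos N by (simp add: field_simps flip: ln_less_cancel_iff[of "exp _"])
  \<comment> \<open>Only finitely many remainders occur, so one radius serves them all.\<close>
  have "\<forall>\<^sub>F k in sequentially. \<forall>r<N. 1 / 2 < centred_prob C x r (real (Suc k))"
  proof -
    have "\<forall>\<^sub>F k in sequentially. \<forall>r\<in>{..<N}. 1 / 2 < centred_prob C x r (real (Suc k))"
      by (intro eventually_ball_finite ballI order_tendstoD(1)[OF centred_prob_tendsto_1[OF C]]) auto
    then show ?thesis by (simp only: Ball_def lessThan_iff)
  qed
  then obtain k where k: "\<And>r. r < N \<Longrightarrow> 1 / 2 < centred_prob C x r (real (Suc k))"
    unfolding eventually_sequentially by (meson order_refl)
  \<comment> \<open>The \<open>q\<close> blocks use at most \<open>n / 2\<close> of the radius,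
    hence what is left, \<open>t\<close>, is at least \<open>n / 2\<close> and so at least
    \<open>Suc k\<close>.\<close>
  have lower: "ln c / real N - ln 2 / real n \<le> ln (centred_prob C x n (real n)) / real n
      \<and> 0 < centred_prob C x n (real n)" if n: "n \<ge> 2 * Suc k" for n
  proof -
    define q r where "q = n div N" and "r = n mod N"
    have r: "r < N" and qr: "n = q * N + r" using N by (simp_all add: q_def r_def)
    define t where "t = real n - real q * (real N / 2)"
    have qN: "real q * real N \<le> real n" using qr by (metis le_add1 of_nat_le_iff of_nat_mult)
    have "2 * real (Suc k) \<le> real n" using n by (metis of_nat_le_iff of_nat_mult of_nat_numeral)
    then have t: "real (Suc k) \<le> t" using qN by (simp add: t_def)
    have "c ^ q * (1 / 2) \<le> c ^ q * centred_prob C x r t"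
      using k[OF r] centred_prob_mono[OF C _ t, of x r] c_pos by (intro mult_left_mono) auto
    also have "\<dots> \<le> centred_prob C x (q * N + r) (real q * (real N / 2) + t)"
      unfolding c_def using N t by (intro centred_prob_power[OF C]) auto
    also have "\<dots> = centred_prob C x n (real n)" unfolding qr[symmetric] t_def by simp
    finally have le: "c ^ q * (1 / 2) \<le> centred_prob C x n (real n)" .
    have pos: "0 < c ^ q * (1 / 2)" using c_pos by simp
    \<comment> \<open>Rounding \<open>n / N\<close> down to \<open>q\<close> goes in the right
      direction because \<open>ln c\<close> is nonpositive.\<close>
    have "real n / real N * ln c \<le> real q * ln c"
      using qN N ln_c by (intro mult_right_mono_neg) (simp_all add: field_simps)
    then have "real n / real N * ln c - ln 2 \<le> ln (c ^ q * (1 / 2))"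
      using c_pos by (simp add: ln_mult ln_div ln_realpow)
    also have "\<dots> \<le> ln (centred_prob C x n (real n))" using le pos by simp
    finally have "(real n / real N * ln c - ln 2) / real n \<le> ln (centred_prob C x n (real n)) / real n"
      by (intro divide_right_mono) auto
    then show ?thesis using le pos n by (simp add: diff_divide_distrib)
  qed
  have "(\<lambda>n. ereal (ln c / real N - ln 2 / real n)) \<longlonglongrightarrow> ereal (ln c / real N - 0)"
    by (intro tendsto_intros lim_const_over_n)
  from lim_imp_Liminf[OF sequentially_bot this]
  have "liminf (\<lambda>n. ereal (ln c / real N - ln 2 / real n)) = ereal (ln c / real N)"
    by simp
  moreover have "liminf (\<lambda>n. ereal (ln c / real N - ln 2 / real n))
      \<le> liminf (\<lambda>n. ereal (1 / real n) * ext_ln (ennreal (centred_prob C x n (real n))))"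
  proof (rule Liminf_mono, rule eventually_sequentiallyI)
    fix n assume "2 * Suc k \<le> n"
    from lower[OF this]
    show "ereal (ln c / real N - ln 2 / real n)
      \<le> ereal (1 / real n) * ext_ln (ennreal (centred_prob C x n (real n)))"
      by (simp add: ext_ln_def)
  qed
  ultimately have "ereal (ln c / real N) < ereal b"
    using less by (simp only: le_less_trans)
  then show False using b by simp
qed

text \<open>\<open>D\<close> may fail to be measurable, so the claim is phrased through measurable
  sets that miss the dilate of \<open>D\<close>. The induction splits off the last summand with
  Fubini.\<close>

lemma sum_law_carried:
  assumes D: "convex D" "carried_by \<mu> D"
    and "A \<in> sets (lcs_sigma C0)" "A \<inter> (*\<^sub>R) (real n) ` D = {}"
  shows "emeasure (sum_law n) A = 0"
  using assms(3,4)
proof (induction n arbitrary: A)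
  case 0
  note [measurable] = 0(1)
  \<comment> \<open>The dilate of \<open>D\<close> by 0 is \<open>{0}\<close> only if
    \<open>D\<close> is nonempty; an empty set cannot carry a probability.\<close>
  have "emeasure \<mu> (space \<mu>) = emeasure \<mu> {}" if "D = {}"
    using D(2)[unfolded carried_by_def, rule_format, of "space \<mu>" "{}"] that by simp
  then have "D \<noteq> {}"
    using emeasure_space_1 by auto
  then have "0 \<notin> A" using 0(2) by auto
  moreover have "emeasure (sum_law 0) A = indicator A 0"
    using nn_integral_sum_law_0[of "indicator A"] by simp
  ultimately show ?case by simp
next
  case (Suc n)
  note [measurable] = Suc.prems(1)
  define h where "h x = (\<integral>\<^sup>+y. indicator A (x + y) \<partial>\<mu>)" for x
  have [measurable]: "h \<in> borel_measurable (lcs_sigma C0)" unfolding h_def by measurable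
  have "h x = 0" if x: "x \<in> (*\<^sub>R) (real n) ` D" for x
  proof -
    define B where "B = {y \<in> space \<mu>. x + y \<in> A}"
    have B [measurable]: "B \<in> sets \<mu>" unfolding B_def by measurable
    have "B \<inter> D = {}"
    proof (rule ccontr)
      assume "B \<inter> D \<noteq> {}"
      then obtain y where y: "y \<in> D" "x + y \<in> A" unfolding B_def by blast
      obtain d where d: "d \<in> D" "x = real n *\<^sub>R d" using x by blast
      \<comment> \<open>Convexity of \<open>D\<close> makes \<open>x + y\<close> an element of
        \<open>D\<close> scaled by \<open>Suc n\<close>, which \<open>A\<close> avoids.\<close>
      have "(real n / real (Suc n)) *\<^sub>R d + (1 / real (Suc n)) *\<^sub>R y \<in> D"
        by (intro convexD[OF D(1)] d y) (auto simp: add_divide_distrib[symmetric])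
      moreover have "x + y = real (Suc n) *\<^sub>R ((real n / real (Suc n)) *\<^sub>R d + (1 / real (Suc n)) *\<^sub>R y)"
        using d by (simp add: scaleR_add_right del: of_nat_Suc)
      ultimately show False using y(2) Suc.prems(2) by blast
    qed
    then have "emeasure \<mu> B = 0"
      using D(2)[unfolded carried_by_def, rule_format, of B "{}"] by simp
    moreover have "h x = (\<integral>\<^sup>+y. indicator B y \<partial>\<mu>)"
      unfolding h_def by (intro nn_integral_cong) (auto simp: B_def indicator_def)
    ultimately show ?thesis by simp
  qed
  \<comment> \<open>The induction hypothesis is applied to the support of \<open>h\<close>, which is
    measurable and misses the dilate of \<open>D\<close> by \<open>n\<close>.\<close>
  moreover define Z where "Z = {x \<in> space (sum_law n). h x \<noteq> 0}"
  moreover have Z: "Z \<in> sets (sum_law n)" unfolding Z_def by measurable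
  ultimately have "emeasure (sum_law n) Z = 0"
    by (intro Suc.IH) (auto simp: Z_def)
  then have "(\<integral>\<^sup>+x. h x \<partial>sum_law n) = 0"
    unfolding Z_def by (subst nn_integral_0_iff) simp_all
  then show ?case
    using nn_integral_sum_law_Suc[of "indicator A" n] by (simp add: h_def)
qed

section \<open>Transfer to the sample means of an i.i.d. sequence\<close>

context
  fixes P :: "'b measure" and X :: "nat \<Rightarrow> 'b \<Rightarrow> 'a"
  assumes P: "prob_space P" and iid: "iid_sequence P \<mu> X"
begin

lemma iid_measurable: "k \<ge> 1 \<Longrightarrow> X k \<in> measurable P \<mu>"
  using iid unfolding iid_sequence_def prob_space.indep_vars_def[OF P] by simp

lemma measurable_sample_mean [measurable]: "sample_mean X n \<in> measurable P (lcs_sigma C0)"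
proof -
  have "(\<lambda>\<omega>. \<Sum>k=1..n. X k \<omega>) \<in> measurable P (lcs_sigma C0)"
    using iid_measurable measurable_cong_sets[OF refl sets_eq_lcs]
    by (intro measurable_lcs_sum) auto
  then show ?thesis
    unfolding sample_mean_def[abs_def] using measurable_compose[OF _ measurable_lcs_scaleR] by blast
qed

text \<open>By independence the joint law of the first \<open>n\<close> variables is the product
  measure on which \<open>sum_law\<close> is built.\<close>

lemma distr_sum_iid:
  assumes "n \<ge> 1"
  shows "distr P (lcs_sigma C0) (\<lambda>\<omega>. \<Sum>k=1..n. X k \<omega>) = sum_law n"
proof -
  let ?Y = "\<lambda>\<omega>. \<lambda>k\<in>{1..n}. X k \<omega>"
  have "prob_space.indep_vars P (\<lambda>_. \<mu>) X {1..n}"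
    using iid unfolding iid_sequence_def
    by (auto intro: prob_space.indep_vars_subset[OF P])
  then have "distr P (PiM {1..n} (\<lambda>_. \<mu>)) ?Y = PiM {1..n} (\<lambda>k. distr P \<mu> (X k))"
    using prob_space.indep_vars_iff_distr_eq_PiM'[OF P, where I = "{1..n}" and M' = "\<lambda>_. \<mu>" and X = X] assms iid_measurable
    by auto
  also have "\<dots> = PiM {1..n} (\<lambda>_. \<mu>)"
    using iid unfolding iid_sequence_def by (intro PiM_cong) auto
  finally have *: "distr P (PiM {1..n} (\<lambda>_. \<mu>)) ?Y = PiM {1..n} (\<lambda>_. \<mu>)" .
  have Y: "?Y \<in> measurable P (PiM {1..n} (\<lambda>_. \<mu>))"
    using iid_measurable by (intro measurable_restrict) auto
  have "sum_law n = distr (distr P (PiM {1..n} (\<lambda>_. \<mu>)) ?Y) (lcs_sigma C0) (\<lambda>x. \<Sum>k\<in>{1..n}. x k)"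
    unfolding sum_law_def * ..
  also have "\<dots> = distr P (lcs_sigma C0) (\<lambda>\<omega>. \<Sum>k=1..n. X k \<omega>)"
    by (subst distr_distr[OF measurable_sum_PiM Y]) (auto intro!: distr_cong simp: comp_def)
  finally show ?thesis by simp
qed

lemma distr_sample_mean:
  assumes "n \<ge> 1"
  shows "distr P (lcs_sigma C0) (sample_mean X n)
    = distr (sum_law n) (lcs_sigma C0) (\<lambda>y. (1 / real n) *\<^sub>R y)"
proof -
  have "(\<lambda>\<omega>. \<Sum>k=1..n. X k \<omega>) \<in> measurable P (lcs_sigma C0)"
    using iid_measurable measurable_cong_sets[OF refl sets_eq_lcs]
    by (intro measurable_lcs_sum) auto
  then show ?thesis
    unfolding distr_sum_iid[OF assms, symmetric]
    by (subst distr_distr) (simp_all add: comp_def sample_mean_def[abs_def])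
qed

lemma emeasure_sample_mean_translate:
  assumes C: "C \<in> C0" and "n \<ge> 1" "0 < t"
  shows "emeasure (distr P (lcs_sigma C0) (sample_mean X n)) ((+) x ` ((*\<^sub>R) t ` C))
    = ennreal (centred_prob C x n (real n * t))"
proof -
  interpret n: prob_space "sum_law n" by (rule prob_space_sum_law)
  have "(\<lambda>y. (1 / real n) *\<^sub>R y) -` ((+) x ` ((*\<^sub>R) t ` C))
      = (+) (real n *\<^sub>R x) ` ((*\<^sub>R) (real n * t) ` C)"
    using assms unfolding vimage_def translate_mem_iff
    by (intro set_eqI) (simp add: dilation_mem_iff translate_mem_iff scaleR_diff_right mult.commute)
  then show ?thesis
    unfolding distr_sample_mean[OF assms(2)] centred_prob_def
    using translate_dilation_sets[OF C assms(3)]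
    by (subst emeasure_distr) (simp_all add: n.emeasure_eq_measure)
qed

lemma emeasure_sample_mean_carried:
  assumes "convex D" "carried_by \<mu> D" "A \<in> sets (lcs_sigma C0)" "A \<inter> D = {}" "n \<ge> 1"
  shows "emeasure (distr P (lcs_sigma C0) (sample_mean X n)) A = 0"
proof -
  let ?B = "(\<lambda>y. (1 / real n) *\<^sub>R y) -` A"
  have "?B \<in> sets (lcs_sigma C0)"
    using measurable_sets[OF measurable_lcs_scaleR assms(3)] by (simp add: space_lcs_sigma)
  moreover have "?B \<inter> (*\<^sub>R) (real n) ` D = {}" using assms(4,5) by auto
  ultimately have "emeasure (sum_law n) ?B = 0" using sum_law_carried assms(1,2) by blast
  then show ?thesis
    unfolding distr_sample_mean[OF assms(5)] using assms(3) by (subst emeasure_distr) simp_all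
qed

text \<open>The infimum defining the entropy drops below \<open>b\<close> at some neighbourhood;
  halving that neighbourhood turns the bound on a liminf into one for every
  \<open>n \<ge> 1\<close>.\<close>

lemma local_upper_bound:
  assumes "entropy_of C0 (\<lambda>n. distr P (lcs_sigma C0) (sample_mean X n)) x < ereal b"
  obtains C where "C \<in> C0"
    and "\<And>n. n \<ge> 1 \<Longrightarrow> emeasure (distr P (lcs_sigma C0) (sample_mean X n)) ((+) x ` C)
           \<le> ennreal (exp (real n * b))"
proof -
  let ?\<nu> = "\<lambda>n. distr P (lcs_sigma C0) (sample_mean X n)"
  obtain C where C: "C \<in> C0"
    and less: "liminf (\<lambda>n. ereal (1 / real n) * ext_ln (emeasure (?\<nu> n) ((+) x ` C))) < ereal b"
    using assms unfolding entropy_of_def INF_less_iff translates_def by blast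
  have "liminf (\<lambda>n. ereal (1 / real n) * ext_ln (emeasure (?\<nu> n) ((+) x ` C)))
    = liminf (\<lambda>n. ereal (1 / real n) * ext_ln (ennreal (centred_prob C x n (real n))))"
    using emeasure_sample_mean_translate[OF C _ zero_less_one, of _ x]
    by (intro Liminf_eq eventually_sequentiallyI[of 1]) simp
  with less have bound: "centred_prob C x n (real n / 2) \<le> exp (real n * b)" if "n \<ge> 1" for n
    using liminf_mean_bound[OF C that] by simp
  show ?thesis
  proof (rule that)
    show "(*\<^sub>R) (1 / 2) ` C \<in> C0" using C by (intro dilation_closed) auto
    show "emeasure (?\<nu> n) ((+) x ` ((*\<^sub>R) (1 / 2) ` C)) \<le> ennreal (exp (real n * b))" if "n \<ge> 1" for n
      unfolding emeasure_sample_mean_translate[OF C that, of "1/2", simplified]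
      using bound[OF that] by (simp add: ennreal_leI)
  qed
qed

end

end

section \<open>Upper semicontinuous envelopes and extended real estimates\<close>

lemma usc_envelope_upper_semicontinuous:
  assumes "topspace T = UNIV"
  shows "upper_semicontinuous T (usc_envelope T f)"
  unfolding upper_semicontinuous_def
proof
  fix t
  let ?G = "{g. upper_semicontinuous T g \<and> f \<le> g}"
  have "{x. Inf ?G x < t} = (\<Union>g\<in>?G. {x. g x < t})"
    by (auto simp: Inf_less_iff Inf_apply INF_less_iff)
  moreover have "openin T (\<Union>g\<in>?G. {x. g x < t})"
    by (rule openin_Union) (auto simp: upper_semicontinuous_def)
  ultimately show "openin T {x. usc_envelope T f x < t}"
    unfolding usc_envelope_eq_Inf[OF assms] by simp
qed

lemma usc_envelope_ge:
  assumes "topspace T = UNIV" shows "f x \<le> usc_envelope T f x"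
proof -
  have "f \<le> usc_envelope T f"
    unfolding usc_envelope_eq_Inf[OF assms] by (rule Inf_greatest) simp
  then show ?thesis by (rule le_funD)
qed

lemma ext_exp_le:
  assumes "y \<le> ereal a" "n \<ge> 1"
  shows "ext_exp (ereal (real n) * y) \<le> ennreal (exp (real n * a))"
  using assms by (cases y) (auto simp: ext_exp_def)

lemma ext_ln_le:
  assumes "y \<le> ennreal c" "0 < c"
  shows "ext_ln y \<le> ereal (ln c)"
  using assms by (cases y) (auto simp: ext_ln_def top_unique)

text \<open>As \<open>-\<infinity> + \<infinity> = \<infinity>\<close>, the hypothesis keeps both
  summands below \<open>\<infinity>\<close>. If both are finite the gap is shared equally; otherwise
  a summand \<open>-\<infinity>\<close> leaves its threshold free.\<close>

lemma ereal_add_less_split: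
  fixes u v :: ereal
  assumes "u + v < ereal l"
  obtains a b where "u < ereal a" "v < ereal b" "a + b \<le> l"
proof (cases u; cases v)
  fix p q assume "u = ereal p" "v = ereal q"
  then show thesis using that[of "p + (l - p - q) / 2" "q + (l - p - q) / 2"] assms
    by (simp add: field_simps)
next
  fix p assume "u = ereal p" "v = - \<infinity>"
  then show thesis using that[of "p + 1" "l - p - 1"] by simp
next
  fix q assume "u = - \<infinity>" "v = ereal q"
  then show thesis using that[of "l - q - 1" "q + 1"] by simp
next
  assume "u = - \<infinity>" "v = - \<infinity>"
  then show thesis using that[of 0 l] by simp
qed (use assms in auto)

section \<open>The upper bound on relatively compact sets\<close>

theorem mainTheorem3:
  fixes C0 :: "'a::real_vector set set" and D K :: "'a set" and \<mu> :: "'a measure"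
    and P :: "'b measure" and X :: "nat \<Rightarrow> 'b \<Rightarrow> 'a"
    and \<nu> :: "nat \<Rightarrow> 'a measure" and s f :: "'a \<Rightarrow> ereal"
  assumes "measurable_lcs C0"
    and "convex D"
    and "prob_space \<mu>" and "sets \<mu> = sets (lcs_sigma C0)"
    and "carried_by \<mu> D"
    and "prob_space P" and "iid_sequence P \<mu> X"
    and "\<And>n. n \<ge> 1 \<Longrightarrow> \<nu> n = distr P (lcs_sigma C0) (sample_mean X n)"
    and "s = entropy_of C0 \<nu>"
    and "f \<in> borel_measurable (lcs_sigma C0)"
    and "K \<in> sets (lcs_sigma C0)"
    and "relatively_compact (lcs_topology C0) (K \<inter> D)"
  shows "limsup (\<lambda>n. ereal (1 / real n) *
            ext_ln (\<integral>\<^sup>+ \<omega>. ext_exp (ereal (real n) * f (sample_mean X n \<omega>))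
                          * indicator K (sample_mean X n \<omega>) \<partial>P))
         \<le> (SUP x\<in>lcs_topology C0 closure_of (K \<inter> D).
               usc_envelope (lcs_topology C0) f x + s x)"

proof -
  interpret lcs_prob_space C0 \<mu>
    using assms(1,3,4) by (intro lcs_prob_space.intro lcs_prob_space_axioms.intro)
  interpret P: prob_space P by fact
  note iid = assms(6,7)
  let ?T = "lcs_topology C0" and ?m = "sample_mean X"
  let ?\<nu> = "\<lambda>n. distr P (lcs_sigma C0) (?m n)"
  let ?L = "?T closure_of (K \<inter> D)"
  let ?E = "\<lambda>n. \<integral>\<^sup>+ \<omega>. ext_exp (ereal (real n) * f (?m n \<omega>)) * indicator K (?m n \<omega>) \<partial>P"
  note [measurable] = measurable_sample_mean[OF iid] assms(11)
  \<comment> \<open>\<open>\<nu> 0\<close> is unconstrained, but a liminf does not see it.\<close>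
  have s: "s = entropy_of C0 ?\<nu>"
    unfolding assms(9) entropy_of_def using assms(8)
    by (intro ext INF_cong refl Liminf_eq eventually_sequentiallyI[of 1]) simp
  obtain Q where Q: "compactin ?T Q" "K \<inter> D \<subseteq> Q"
    using assms(12) unfolding relatively_compact_def by blast
  \<comment> \<open>Compact sets are closed in a Hausdorff space, so the closure stays inside
    \<open>Q\<close>.\<close>
  have "?L \<subseteq> Q"
    using closure_of_minimal[OF Q(2) compactin_imp_closedin[OF Hausdorff_lcs_topology Q(1)]] .
  then have compact: "compactin ?T ?L" using closed_compactin[OF Q(1)] by simp
  have subset: "K \<inter> D \<subseteq> ?L" by (rule closure_of_subset) (simp add: topspace_lcs_topology)
  show ?thesis
  proof (rule dense_ge)
    fix z assume z: "(SUP x\<in>?L. usc_envelope ?T f x + s x) < z"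
    show "limsup (\<lambda>n. ereal (1 / real n) * ext_ln (?E n)) \<le> z"
    \<comment> \<open>\<open>z = \<infinity>\<close> is trivial and \<open>z = -\<infinity>\<close>
      is excluded by \<open>z\<close> lying strictly above the supremum. Real \<open>z\<close> also
      covers a supremum equal to \<open>-\<infinity>\<close>.\<close>
    proof (cases z)
      case (real l)
      have "\<exists>C a b. C \<in> C0 \<and> a + b \<le> l \<and> (\<forall>y\<in>(+) x ` C. f y \<le> ereal a) \<and>
          (\<forall>n\<ge>1. emeasure (?\<nu> n) ((+) x ` C) \<le> ennreal (exp (real n * b)))" if x: "x \<in> ?L" for x
      proof -
        have "usc_envelope ?T f x + s x < ereal l"
          using z x unfolding real by (meson SUP_upper le_less_trans)
        then obtain a b where ab: "usc_envelope ?T f x < ereal a" "s x < ereal b" "a + b \<le> l"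
          by (rule ereal_add_less_split)
        obtain B where B: "B \<in> C0"
          "\<And>n. n \<ge> 1 \<Longrightarrow> emeasure (?\<nu> n) ((+) x ` B) \<le> ennreal (exp (real n * b))"
          using local_upper_bound[OF iid] ab(2) unfolding s by blast
        have "openin ?T {y. usc_envelope ?T f y < ereal a}"
          using usc_envelope_upper_semicontinuous[OF topspace_lcs_topology]
          unfolding upper_semicontinuous_def by blast
        then obtain A where A: "A \<in> C0" "(+) x ` A \<subseteq> {y. usc_envelope ?T f y < ereal a}"
          unfolding openin_lcs_topology using ab(1) by blast
        show ?thesis
        proof (intro exI conjI ballI allI impI)
          \<comment> \<open>\<open>A\<close> controls \<open>f\<close> and \<open>B\<close> controls
            the probabilities; both bounds hold on the intersection.\<close>
          show "A \<inter> B \<in> C0" using A(1) B(1) by (rule Int_closed)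
          show "f y \<le> ereal a" if "y \<in> (+) x ` (A \<inter> B)" for y
          proof -
            have "usc_envelope ?T f y < ereal a" using A(2) that by blast
            with usc_envelope_ge[OF topspace_lcs_topology, of f y] show ?thesis by simp
          qed
          show "emeasure (?\<nu> n) ((+) x ` (A \<inter> B)) \<le> ennreal (exp (real n * b))" if "1 \<le> n" for n
          proof (rule order_trans[OF emeasure_mono B(2)[OF that]])
            show "(+) x ` B \<in> sets (?\<nu> n)" using translate_in_lcs_sigma[OF B(1)] by simp
          qed blast
        qed (rule ab(3))
      qed
      then obtain C a b where C: "\<And>x. x \<in> ?L \<Longrightarrow> C x \<in> C0"
        and ab: "\<And>x. x \<in> ?L \<Longrightarrow> a x + b x \<le> l"
        and f_le: "\<And>x y. x \<in> ?L \<Longrightarrow> y \<in> (+) x ` C x \<Longrightarrow> f y \<le> ereal (a x)"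
        and \<nu>_le: "\<And>x n. x \<in> ?L \<Longrightarrow> n \<ge> 1 \<Longrightarrow>
          emeasure (?\<nu> n) ((+) x ` C x) \<le> ennreal (exp (real n * b x))"
        by metis
      define U where "U x = (+) x ` C x" for x
      have "\<exists>\<F>. finite \<F> \<and> \<F> \<subseteq> U ` ?L \<and> ?L \<subseteq> \<Union>\<F>"
      proof (rule compactinD[OF compact])
        show "openin ?T V" if "V \<in> U ` ?L" for V
          using that C openin_translate unfolding U_def by blast
        show "?L \<subseteq> \<Union>(U ` ?L)"
        proof
          fix x assume x: "x \<in> ?L"
          have "x \<in> U x" unfolding U_def translate_mem_iff using C0_zero[OF C[OF x]] by simp
          with x show "x \<in> \<Union>(U ` ?L)" by blast
        qed
      qed
      then obtain J where J: "finite J" "J \<subseteq> ?L" "?L \<subseteq> \<Union>(U ` J)"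
        by (metis finite_subset_image)
      have U [measurable]: "U x \<in> sets (lcs_sigma C0)" if "x \<in> J" for x
        using J(2) C that translate_in_lcs_sigma unfolding U_def by blast
      \<comment> \<open>\<open>Suc (card J)\<close> instead of \<open>card J\<close> keeps the
        constant positive when \<open>J\<close> is empty, so that its logarithm can be used.\<close>
      have E_le: "?E n \<le> ennreal (real (Suc (card J)) * exp (real n * l))" if n: "n \<ge> 1" for n
      proof -
        \<comment> \<open>The uncovered part of \<open>K\<close> misses \<open>D\<close> and is
          therefore null for the law of the mean.\<close>
        define R where "R = K - \<Union>(U ` J)"
        have R: "R \<in> sets (lcs_sigma C0)"
          unfolding R_def using J(1) U by (intro sets.Diff sets.finite_UN assms(11)) auto
        have "R \<inter> D = {}" using subset J(3) unfolding R_def by blast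
        then have "emeasure (?\<nu> n) R = 0"
          by (rule emeasure_sample_mean_carried[OF iid assms(2,5) R _ n])
        then have "AE y in ?\<nu> n. y \<notin> R" using R by (intro AE_not_in) auto
        then have "AE \<omega> in P. ?m n \<omega> \<notin> R"
          using R by (subst (asm) AE_distr_iff) auto
        then have "AE \<omega> in P. ext_exp (ereal (real n) * f (?m n \<omega>)) * indicator K (?m n \<omega>)
            \<le> (\<Sum>x\<in>J. ennreal (exp (real n * a x)) * indicator (U x) (?m n \<omega>))"
        proof eventually_elim
          case (elim \<omega>)
          show ?case
          proof (cases "?m n \<omega> \<in> K")
            case True
            with elim obtain x where x: "x \<in> J" "?m n \<omega> \<in> U x" unfolding R_def by blast
            have "ext_exp (ereal (real n) * f (?m n \<omega>)) \<le> ennreal (exp (real n * a x))"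
              using f_le x J(2) n unfolding U_def by (intro ext_exp_le) auto
            also have "\<dots> = ennreal (exp (real n * a x)) * indicator (U x) (?m n \<omega>)" using x by simp
            also have "\<dots> \<le> (\<Sum>x\<in>J. ennreal (exp (real n * a x)) * indicator (U x) (?m n \<omega>))"
              using J(1) x(1) by (intro member_le_sum) auto
            finally show ?thesis using True by simp
          qed simp
        qed
        then have "?E n \<le> (\<integral>\<^sup>+ \<omega>. (\<Sum>x\<in>J. ennreal (exp (real n * a x)) * indicator (U x) (?m n \<omega>)) \<partial>P)"
          by (rule nn_integral_mono_AE)
        also have "\<dots> = (\<Sum>x\<in>J. ennreal (exp (real n * a x)) * emeasure (?\<nu> n) (U x))"
        proof (subst nn_integral_sum)
          show "(\<Sum>x\<in>J. \<integral>\<^sup>+ \<omega>. ennreal (exp (real n * a x)) * indicator (U x) (?m n \<omega>) \<partial>P)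
              = (\<Sum>x\<in>J. ennreal (exp (real n * a x)) * emeasure (?\<nu> n) (U x))"
          proof (rule sum.cong[OF refl])
            fix x assume "x \<in> J"
            note [measurable] = U[OF this]
            have "(\<integral>\<^sup>+ \<omega>. indicator (U x) (?m n \<omega>) \<partial>P) = emeasure (?\<nu> n) (U x)"
              by (subst nn_integral_distr[symmetric, of _ _ "lcs_sigma C0" "indicator (U x)"]) simp_all
            then show "(\<integral>\<^sup>+ \<omega>. ennreal (exp (real n * a x)) * indicator (U x) (?m n \<omega>) \<partial>P)
                = ennreal (exp (real n * a x)) * emeasure (?\<nu> n) (U x)"
              by (subst nn_integral_cmult) simp_all
          qed
        qed (use U in measurable)
        also have "\<dots> \<le> (\<Sum>x\<in>J. ennreal (exp (real n * l)))"
        proof (rule sum_mono)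
          fix x assume "x \<in> J"
          then have x: "x \<in> ?L" using J(2) by blast
          \<comment> \<open>Both bounds belong to the same neighbourhood, so the exponents combine
            to \<open>a x + b x\<close>, which is at most \<open>l\<close>.\<close>
          have "ennreal (exp (real n * a x)) * emeasure (?\<nu> n) (U x)
              \<le> ennreal (exp (real n * a x)) * ennreal (exp (real n * b x))"
            unfolding U_def by (intro mult_left_mono \<nu>_le[OF x n]) simp
          also have "\<dots> = ennreal (exp (real n * (a x + b x)))"
            by (simp add: ennreal_mult[symmetric] exp_add[symmetric] distrib_left)
          also have "\<dots> \<le> ennreal (exp (real n * l))"
            using ab[OF x] by (intro ennreal_leI) (simp add: mult_left_mono)
          finally show "ennreal (exp (real n * a x)) * emeasure (?\<nu> n) (U x) \<le> ennreal (exp (real n * l))" .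
        qed
        also have "\<dots> = ennreal (real (card J) * exp (real n * l))"
          by (simp add: ennreal_mult ennreal_of_nat_eq_real_of_nat)
        also have "\<dots> \<le> ennreal (real (Suc (card J)) * exp (real n * l))"
          by (intro ennreal_leI mult_right_mono) auto
        finally show ?thesis .
      qed
      \<comment> \<open>The number of neighbourhoods does not depend on \<open>n\<close>, so its
        logarithm vanishes after division by \<open>n\<close>.\<close>
      have "limsup (\<lambda>n. ereal (1 / real n) * ext_ln (?E n))
          \<le> limsup (\<lambda>n. ereal (ln (real (Suc (card J))) / real n + l))"
      proof (rule Limsup_mono, rule eventually_sequentiallyI)
        fix n :: nat assume n: "1 \<le> n"
        have "ext_ln (?E n) \<le> ereal (ln (real (Suc (card J)) * exp (real n * l)))"
          by (rule ext_ln_le[OF E_le[OF n]]) simp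
        then have "ereal (1 / real n) * ext_ln (?E n)
            \<le> ereal (1 / real n) * ereal (ln (real (Suc (card J)) * exp (real n * l)))"
          by (rule ereal_mult_left_mono) simp
        also have "\<dots> = ereal (ln (real (Suc (card J))) / real n + l)"
          using n by (simp add: ln_mult field_simps del: of_nat_Suc)
        finally show "ereal (1 / real n) * ext_ln (?E n) \<le> ereal (ln (real (Suc (card J))) / real n + l)" .
      qed
      also have "\<dots> = ereal l"
      proof (rule lim_imp_Limsup[OF sequentially_bot])
        have "(\<lambda>n. ereal (ln (real (Suc (card J))) / real n + l)) \<longlonglongrightarrow> ereal (0 + l)"
          by (intro tendsto_intros lim_const_over_n)
        then show "(\<lambda>n. ereal (ln (real (Suc (card J))) / real n + l)) \<longlonglongrightarrow> ereal l" by simp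
      qed
      finally show ?thesis unfolding real .
    qed (use z in auto)
  qed
qed

end
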